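(* For every partial sign matrix $A\in\{-1,1,*\}^{M\times N}$, $$\mathrm{VC}(A)-1\le \operatorname{coind}_{\mathbb{Z}_2}(S(A)).$$
   Context: VC dimension. For $A\in\{-1,1,*\}^{M\times N}$ (with $M,N\ge 1$), $\mathrm{VC}(A)$ is the largest $d$ for which there is a set of columns $S\subseteq[N]$ with $|S|=d$ such that every sign pattern $P\in\{-1,1\}^S$ appears as the restriction to $S$ of some row of $A$. Sign complex. For each row $r$ of $A$, let $\sigma_r^+=\{i^+: r_i=+1\}\cup\{i^-: r_i=-1\}$ and $\sigma_r^-=\{i^-: r_i=+1\}\cup\{i^+: r_i=-1\}$, subsets of $\{1^+,1^-,\dots,N^+,N^-\}$. The sign complex $S(A)$ is the abstract simplicial complex whose simplices are all subsets of $\sigma_r^+$ or $\sigma_r^-$ over all rows $r$. The involution $i^+\leftrightarrow i^-$ is a free simplicial $\mathbb{Z}_2$-action on $S(A)$, inducing a free action on the geometric realization $|S(A)|$. Coindex. For a free $\mathbb{Z}_2$-complex $K$, $\operatorname{coind}_{\mathbb{Z}_2}(K)$ is the maximum $d\ge 0$ for which there is a continuous $\mathbb{Z}_2$-equivariant map $\mathbb{S}^d\to|K|$, where $\mathbb{S}^d$ carries the antipodal action; it is $-1$ if $|K|=\emptyset$. *)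

theory Defs
  imports "HOL-Analysis.Analysis"
begin

datatype sgn = Neg | Pos

instance sgn :: finite
proof
  have "(UNIV :: sgn set) = {Neg, Pos}"
    using sgn.exhaust by auto
  then show "finite (UNIV :: sgn set)"
    by (metis finite.emptyI finite.insertI)
qed

fun flip :: "sgn \<Rightarrow> sgn" where
  "flip Pos = Neg"
| "flip Neg = Pos"

(* Matrices with rows 'm and columns 'n; an undetermined entry * is None.
   As types are nonempty, there is at least one row and one column. *)
type_synonym ('n, 'm) partial_sign_matrix = "((sgn option, 'n) vec, 'm) vec"

definition shattered :: "('n::finite, 'm::finite) partial_sign_matrix \<Rightarrow> 'n set \<Rightarrow> bool" where
  "shattered A S \<longleftrightarrow> (\<forall>P :: 'n \<Rightarrow> sgn. \<exists>r. \<forall>i\<in>S. A $ r $ i = Some (P i))"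

definition VC :: "('n::finite, 'm::finite) partial_sign_matrix \<Rightarrow> nat" where
  "VC A = Max {card S | S. shattered A S}"

(* The vertices i^+ and i^- are (i, Pos) and (i, Neg). *)
definition sigma_plus :: "('n::finite, 'm::finite) partial_sign_matrix \<Rightarrow> 'm \<Rightarrow> ('n \<times> sgn) set" where
  "sigma_plus A r = {(i, Pos) | i. A $ r $ i = Some Pos} \<union> {(i, Neg) | i. A $ r $ i = Some Neg}"

definition sigma_minus :: "('n::finite, 'm::finite) partial_sign_matrix \<Rightarrow> 'm \<Rightarrow> ('n \<times> sgn) set" where
  "sigma_minus A r = {(i, Neg) | i. A $ r $ i = Some Pos} \<union> {(i, Pos) | i. A $ r $ i = Some Neg}"

definition sign_complex :: "('n::finite, 'm::finite) partial_sign_matrix \<Rightarrow> ('n \<times> sgn) set set" where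
  "sign_complex A = {\<tau>. \<exists>r. \<tau> \<subseteq> sigma_plus A r \<or> \<tau> \<subseteq> sigma_minus A r}"

definition swap_sign :: "'n \<times> sgn \<Rightarrow> 'n \<times> sgn" where
  "swap_sign = (\<lambda>(i, s). (i, flip s))"

(* Barycentric coordinates. With finitely many vertices the topology of the
   realization is the subspace topology of the Euclidean space real^'v. *)
definition realization :: "'v::finite set set \<Rightarrow> (real ^ 'v) set" where
  "realization K = {x. (\<forall>v. 0 \<le> x $ v) \<and> (\<Sum>v\<in>UNIV. x $ v) = 1 \<and> {v. x $ v \<noteq> 0} \<in> K}"

(* The affine extension to the realization of a map of vertices. *)
definition realization_map :: "('v::finite \<Rightarrow> 'w::finite) \<Rightarrow> real ^ 'v \<Rightarrow> real ^ 'w" where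
  "realization_map g x = (\<chi> w. \<Sum>v | g v = w. x $ v)"

definition free_Z2_complex :: "('v::finite \<Rightarrow> 'v) \<Rightarrow> 'v set set \<Rightarrow> bool" where
  "free_Z2_complex \<nu> K \<longleftrightarrow>
     (\<forall>\<sigma>\<in>K. \<forall>\<tau>. \<tau> \<subseteq> \<sigma> \<longrightarrow> \<tau> \<in> K) \<and>
     (\<forall>v. \<nu> (\<nu> v) = v) \<and>
     (\<forall>\<sigma>\<in>K. \<nu> ` \<sigma> \<in> K) \<and>
     (\<forall>x\<in>realization K. realization_map \<nu> x \<noteq> x)"

(* nsphere d is the unit sphere of R^(d+1), carried by the sequences that
   vanish beyond index d. *)
definition equivariant_sphere_map ::
    "('v::finite \<Rightarrow> 'v) \<Rightarrow> 'v set set \<Rightarrow> nat \<Rightarrow> ((nat \<Rightarrow> real) \<Rightarrow> real ^ 'v) \<Rightarrow> bool" where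
  "equivariant_sphere_map \<nu> K d f \<longleftrightarrow>
     continuous_map (nsphere d) (top_of_set (realization K)) f \<and>
     (\<forall>x\<in>topspace (nsphere d). f (\<lambda>i. - x i) = realization_map \<nu> (f x))"

(* The supremum is taken in ereal: it is the maximum over d if the admissible
   dimensions are bounded, as they are for free actions by Borsuk-Ulam,
   and infinity otherwise. *)
definition coind :: "('v::finite \<Rightarrow> 'v) \<Rightarrow> 'v set set \<Rightarrow> ereal" where
  "coind \<nu> K =
     (if realization K = {} then -1
      else (SUP d \<in> {d. \<exists>f. equivariant_sphere_map \<nu> K d f}. ereal (real d)))"

lemma flip_flip [simp]: "flip (flip s) = s"
  by (cases s) auto

lemma swap_sign_swap_sign [simp]: "swap_sign (swap_sign v) = v"
  by (cases v) (simp add: swap_sign_def)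

lemma swap_sign_sigma_plus: "swap_sign ` sigma_plus A r = sigma_minus A r"
  by (force simp: swap_sign_def sigma_plus_def sigma_minus_def)

lemma swap_sign_sigma_minus: "swap_sign ` sigma_minus A r = sigma_plus A r"
  unfolding swap_sign_sigma_plus [symmetric] by (simp add: image_image)

lemma realization_map_swap_sign:
  "realization_map swap_sign x $ v = x $ swap_sign v"
proof -
  have "{u. swap_sign u = v} = {swap_sign v}"
    by (auto intro: swap_sign_swap_sign [symmetric])
  then show ?thesis
    by (simp add: realization_map_def)
qed

lemma free_Z2_complex_sign_complex:
  "free_Z2_complex swap_sign (sign_complex (A :: ('n::finite, 'm::finite) partial_sign_matrix))"
  unfolding free_Z2_complex_def
proof (intro conjI ballI allI impI)
  fix \<sigma> \<tau> assume "\<sigma> \<in> sign_complex A" "\<tau> \<subseteq> \<sigma>"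
  then show "\<tau> \<in> sign_complex A"
    unfolding sign_complex_def by blast
next
  fix v :: "'n \<times> sgn"
  show "swap_sign (swap_sign v) = v" by simp
next
  fix \<sigma> assume "\<sigma> \<in> sign_complex A"
  then show "swap_sign ` \<sigma> \<in> sign_complex A"
    unfolding sign_complex_def
    using swap_sign_sigma_plus [of A] swap_sign_sigma_minus [of A]
    by (smt (verit) image_mono mem_Collect_eq)
next
  fix x assume x: "x \<in> realization (sign_complex A)"
  show "realization_map swap_sign x \<noteq> x"
  proof
    assume eq: "realization_map swap_sign x = x"
    have sym: "x $ swap_sign v = x $ v" for v
      using realization_map_swap_sign [of x v] eq by simp
    have "(\<Sum>v\<in>UNIV. x $ v) \<noteq> 0"
      using x by (simp add: realization_def)
    then obtain v where v: "x $ v \<noteq> 0"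
      by (meson sum.neutral)
    obtain i s where v_eq: "v = (i, s)" by fastforce
    have supp: "(i, Pos) \<in> {v. x $ v \<noteq> 0}" "(i, Neg) \<in> {v. x $ v \<noteq> 0}"
      using v sym [of v] by (cases s; simp add: v_eq swap_sign_def)+
    obtain r where "{v. x $ v \<noteq> 0} \<subseteq> sigma_plus A r \<or> {v. x $ v \<noteq> 0} \<subseteq> sigma_minus A r"
      using x by (auto simp: realization_def sign_complex_def)
    with supp have "{(i, Pos), (i, Neg)} \<subseteq> sigma_plus A r \<or> {(i, Pos), (i, Neg)} \<subseteq> sigma_minus A r"
      by blast
    then show False
      by (auto simp: sigma_plus_def sigma_minus_def)
  qed
qed

end

theory Submission
  imports Defs
begin

text \<open>
  A shattered set \<open>S\<close> of \<open>d + 1\<close> columns places a copy of the boundary of the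
  \<open>(d + 1)\<close>-dimensional cross-polytope inside the sign complex: a facet of the boundary chooses
  one of \<open>i\<^sup>+\<close>, \<open>i\<^sup>-\<close> for each \<open>i \<in> S\<close>, that is, a sign pattern on \<open>S\<close>, and the row that
  realizes this pattern has the facet among the faces of its simplex. The swap of signs acts
  on the cross-polytope as the antipodal map. Radial projection onto the unit sphere of the
  \<open>1\<close>-norm identifies the sphere of dimension \<open>d\<close> with the boundary of the cross-polytope
  equivariantly, so the coindex is at least \<open>d\<close>.

  The projection is \<open>cross_polytope_map\<close>, and \<open>cross_polytope_coind\<close> is the resulting bound for
  any complex that contains such a cross-polytope boundary. If the VC dimension is \<open>0\<close> and the
  realization is empty, both sides are \<open>-1\<close>. If the VC dimension is \<open>0\<close> and the realization is not
  empty, the supremum that defines the coindex has to be shown to range over a nonempty set: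
  a vertex and its antipode form a cross-polytope boundary of dimension \<open>0\<close>.
\<close>

fun sgn_val :: "sgn \<Rightarrow> real" where
  "sgn_val Pos = 1"
| "sgn_val Neg = -1"

lemma sgn_val_flip [simp]: "sgn_val (flip s) = - sgn_val s"
  by (cases s) auto

lemma UNIV_sgn: "(UNIV :: sgn set) = {Neg, Pos}"
  using sgn.exhaust by auto

lemma sum_pos_parts: "(\<Sum>s\<in>UNIV. max 0 (sgn_val s * t)) = \<bar>t\<bar>"
  by (simp add: UNIV_sgn)

text \<open>
  The point of the \<open>1\<close>-norm unit sphere on the ray through \<open>x\<close>, in barycentric coordinates:
  its coordinate in direction \<open>i\<close> is split into a positive part, the weight of \<open>i\<^sup>+\<close>, and a
  negative part, the weight of \<open>i\<^sup>-\<close>. The bijection \<open>h\<close> from \<open>S\<close> to \<open>{..d}\<close> labels the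
  coordinates of the sphere by the columns.
\<close>

definition cross_polytope_map ::
    "nat \<Rightarrow> 'n set \<Rightarrow> ('n \<Rightarrow> nat) \<Rightarrow> (nat \<Rightarrow> real) \<Rightarrow> real ^ ('n::finite \<times> sgn)" where
  "cross_polytope_map d S h x =
     (\<chi> v. if fst v \<in> S then max 0 (sgn_val (snd v) * x (h (fst v))) / (\<Sum>j\<le>d. \<bar>x j\<bar>) else 0)"

lemma nsphere_l1_norm_pos:
  assumes "x \<in> topspace (nsphere d)"
  shows "0 < (\<Sum>j\<le>d. \<bar>x j\<bar>)"
proof (rule ccontr)
  assume "\<not> 0 < (\<Sum>j\<le>d. \<bar>x j\<bar>)"
  then have "(\<Sum>j\<le>d. \<bar>x j\<bar>) = 0"
    by (meson abs_ge_zero linorder_not_less order_antisym sum_nonneg)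
  then have "\<forall>j\<le>d. x j = 0"
    by (simp add: sum_nonneg_eq_0_iff)
  then show False
    using assms by (simp add: nsphere)
qed

lemma cross_polytope_map_antipode:
  "cross_polytope_map d S h (\<lambda>i. - x i) = realization_map swap_sign (cross_polytope_map d S h x)"
proof -
  have "cross_polytope_map d S h (\<lambda>i. - x i) $ v = cross_polytope_map d S h x $ swap_sign v" for v
    by (cases v) (simp add: cross_polytope_map_def swap_sign_def)
  then show ?thesis
    by (simp add: vec_eq_iff realization_map_swap_sign)
qed

lemma continuous_on_cross_polytope_map:
  fixes S :: "'n::finite set"
  shows "continuous_on (topspace (nsphere d)) (cross_polytope_map d S h)"
  unfolding cross_polytope_map_def
proof (rule continuous_on_vec_lambda)
  have coord: "continuous_on (topspace (nsphere d)) (\<lambda>x. x j)" for j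
    using continuous_on_product_coordinates subset_UNIV by (rule continuous_on_subset)
  have nonzero: "\<forall>x\<in>topspace (nsphere d). (\<Sum>j\<le>d. \<bar>x j\<bar>) \<noteq> 0"
    by (metis less_irrefl nsphere_l1_norm_pos)
  have "continuous_on (topspace (nsphere d)) (\<lambda>x. max 0 (c * x j) / (\<Sum>j\<le>d. \<bar>x j\<bar>))" for c j
    by (intro continuous_on_divide continuous_on_max continuous_on_const continuous_on_mult_left
        continuous_on_sum continuous_on_rabs coord nonzero)
  then show "continuous_on (topspace (nsphere d)) (\<lambda>x. if fst v \<in> S
      then max 0 (sgn_val (snd v) * x (h (fst v))) / (\<Sum>j\<le>d. \<bar>x j\<bar>) else 0)"
    for v :: "'n \<times> sgn"
    by (cases "fst v \<in> S") simp_all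
qed

lemma cross_polytope_map_in_realization:
  assumes h: "bij_betw h S {..d}"
    and facets: "\<And>P. (\<lambda>i. (i, P i)) ` S \<in> K"
    and down: "\<And>\<sigma> \<tau>. \<sigma> \<in> K \<Longrightarrow> \<tau> \<subseteq> \<sigma> \<Longrightarrow> \<tau> \<in> K"
    and x: "x \<in> topspace (nsphere d)"
  shows "cross_polytope_map d S h x \<in> realization K"
proof -
  let ?f = "cross_polytope_map d S h x" and ?T = "\<Sum>j\<le>d. \<bar>x j\<bar>"
  have T: "0 < ?T"
    by (rule nsphere_l1_norm_pos [OF x])
  have "(\<Sum>v\<in>UNIV. ?f $ v) = (\<Sum>i\<in>UNIV. \<Sum>s\<in>UNIV. ?f $ (i, s))"
    by (simp add: sum.cartesian_product)
  also have "\<dots> = (\<Sum>i\<in>UNIV. if i \<in> S then \<bar>x (h i)\<bar> / ?T else 0)"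
    by (rule sum.cong)
      (auto simp: cross_polytope_map_def sum_pos_parts simp flip: sum_divide_distrib)
  also have "\<dots> = (\<Sum>i\<in>S. \<bar>x (h i)\<bar>) / ?T"
    by (simp add: sum_divide_distrib flip: sum.inter_restrict)
  also have "(\<Sum>i\<in>S. \<bar>x (h i)\<bar>) = ?T"
    by (rule sum.reindex_bij_betw [OF h])
  finally have total: "(\<Sum>v\<in>UNIV. ?f $ v) = 1"
    using T by simp
  \<comment> \<open>The support lies in the facet chosen by the signs of \<open>x\<close>; a vanishing coordinate has
    weight \<open>0\<close> at both of its vertices, so its sign is arbitrary.\<close>
  have "{v. ?f $ v \<noteq> 0} \<subseteq> (\<lambda>i. (i, if 0 < x (h i) then Pos else Neg)) ` S"
  proof
    fix v assume v: "v \<in> {v. ?f $ v \<noteq> 0}"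
    obtain i s where vis: "v = (i, s)" by fastforce
    show "v \<in> (\<lambda>i. (i, if 0 < x (h i) then Pos else Neg)) ` S"
      using v unfolding vis
      by (cases s) (auto simp: cross_polytope_map_def image_iff max_def split: if_splits)
  qed
  then have "{v. ?f $ v \<noteq> 0} \<in> K"
    by (rule down [OF facets])
  moreover have "0 \<le> ?f $ v" for v
    using T by (simp add: cross_polytope_map_def)
  ultimately show ?thesis
    using total by (simp add: realization_def)
qed

text \<open>
  The first hypothesis on \<open>K\<close> says that it contains the facets of the cross-polytope boundary with
  the antipodal pairs of vertices \<open>i\<^sup>+\<close>, \<open>i\<^sup>-\<close> for \<open>i \<in> S\<close>; being closed under subsets, \<open>K\<close> then
  contains the whole boundary, which receives the sphere.
\<close>

lemma cross_polytope_coind: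
  fixes K :: "('n::finite \<times> sgn) set set"
  assumes S: "card S = Suc d"
    and facets: "\<And>P. (\<lambda>i. (i, P i)) ` S \<in> K"
    and down: "\<And>\<sigma> \<tau>. \<sigma> \<in> K \<Longrightarrow> \<tau> \<subseteq> \<sigma> \<Longrightarrow> \<tau> \<in> K"
  shows "ereal (real d) \<le> coind swap_sign K"
proof -
  obtain h where h: "bij_betw h S {..d}"
    using ex_bij_betw_finite_nat [of S] S
    by (auto simp: atLeast0LessThan lessThan_Suc_atMost)
  let ?f = "cross_polytope_map d S h"
  have range: "?f x \<in> realization K" if "x \<in> topspace (nsphere d)" for x
    using cross_polytope_map_in_realization [OF h facets down that] .
  have sphere: "top_of_set (topspace (nsphere d)) = nsphere d"
    by (simp add: nsphere euclidean_product_topology)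
  have "continuous_map (nsphere d) euclidean ?f"
    using continuous_on_cross_polytope_map [of d S h]
    by (simp only: sphere flip: continuous_map_iff_continuous)
  then have "continuous_map (nsphere d) (top_of_set (realization K)) ?f"
    using range by (simp add: continuous_map_in_subtopology)
  then have equivariant: "equivariant_sphere_map swap_sign K d ?f"
    by (simp add: equivariant_sphere_map_def cross_polytope_map_antipode)
  have "realization K \<noteq> {}"
    using range [OF in_topspace_nsphere] by blast
  then show ?thesis
    using equivariant by (auto simp: coind_def intro!: SUP_upper)
qed

lemma shattered_card_eq_VC:
  fixes A :: "('n::finite, 'm::finite) partial_sign_matrix"
  obtains S where "shattered A S" "card S = VC A"
proof -
  have "VC A \<in> {card S | S. shattered A S}"
    unfolding VC_def by (rule Max_in) (auto simp: shattered_def)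
  then show ?thesis
    using that by auto
qed

lemma sign_complex_subset:
  "\<sigma> \<in> sign_complex A \<Longrightarrow> \<tau> \<subseteq> \<sigma> \<Longrightarrow> \<tau> \<in> sign_complex A"
  unfolding sign_complex_def by blast

lemma shattered_facet_in_sign_complex:
  assumes "shattered A S"
  shows "(\<lambda>i. (i, P i)) ` S \<in> sign_complex A"
proof -
  obtain r where r: "\<forall>i\<in>S. A $ r $ i = Some (P i)"
    using assms by (auto simp: shattered_def)
  have "(i, P i) \<in> sigma_plus A r" if "i \<in> S" for i
    using r that by (cases "P i") (auto simp: sigma_plus_def)
  then show ?thesis
    by (auto simp: sign_complex_def)
qed

text \<open>
  The two simplices of a row are antipodal, so every vertex comes together with its antipode.
\<close>

lemma vertices_in_sign_complex:
  assumes "realization (sign_complex A) \<noteq> {}"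
  obtains i where "\<And>s. {(i, s)} \<in> sign_complex A"
proof -
  obtain x where "x \<in> realization (sign_complex A)"
    using assms by blast
  then have x: "(\<Sum>v\<in>UNIV. x $ v) = 1" "{v. x $ v \<noteq> 0} \<in> sign_complex A"
    by (simp_all add: realization_def)
  obtain i s where "x $ (i, s) \<noteq> 0"
    using x(1) by (metis sum.neutral surj_pair zero_neq_one)
  then have vertex: "{(i, s)} \<in> sign_complex A"
    using sign_complex_subset [OF x(2)] by simp
  then have "swap_sign ` {(i, s)} \<in> sign_complex A"
    using free_Z2_complex_sign_complex [of A] unfolding free_Z2_complex_def by blast
  then have "{(i, flip s)} \<in> sign_complex A"
    by (simp add: swap_sign_def)
  then have "{(i, t)} \<in> sign_complex A" for t
    using vertex by (cases s; cases t) auto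
  then show ?thesis
    by (rule that)
qed

theorem proposition6:
  fixes A :: "('n::finite, 'm::finite) partial_sign_matrix"
  shows "ereal (real (VC A)) - 1 \<le> coind swap_sign (sign_complex A)"
proof (cases "VC A")
  case (Suc d)
  obtain S where S: "shattered A S" "card S = VC A"
    by (rule shattered_card_eq_VC)
  have "ereal (real d) \<le> coind swap_sign (sign_complex A)"
    using S Suc
    by (intro cross_polytope_coind [of S]) (auto intro: shattered_facet_in_sign_complex sign_complex_subset)
  then show ?thesis
    by (simp add: Suc one_ereal_def)
next
  case 0
  show ?thesis
  proof (cases "realization (sign_complex A) = {}")
    case True
    then show ?thesis
      by (simp add: 0 coind_def one_ereal_def)
  next
    case False
    then obtain i where i: "\<And>s. {(i, s)} \<in> sign_complex A"
      using vertices_in_sign_complex by blast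
    have "ereal (real 0) \<le> coind swap_sign (sign_complex A)"
      by (rule cross_polytope_coind [of "{i}"]) (auto intro: i sign_complex_subset)
    then show ?thesis
      by (rule order_trans [rotated]) (simp add: 0 one_ereal_def)
  qed
qed

end
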